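(* Let $n\ge 2$, let $K$ be a convex body in $\mathbb{R}^n$ and let $(u_i)$ be an evenly spread sequence in $S^{n-1}$. If $\hat P_k$ is an output from Algorithm NoisySupportLSQ (described in the context), run with the directions $u_1,\dots,u_k$ and noisy support function measurements of $K$, then, almost surely, $$\lim_{k\to\infty}\delta(K,\hat P_k)=0 .$$
   Context: $S^{n-1}$ is the unit sphere in $\mathbb{R}^n$. A convex body is a compact convex set with nonempty interior. For a nonempty compact convex set $L$, $h_L(x)=\max\{x\cdot y:y\in L\}$ is its support function, and $\delta(K,L)=\sup_{u\in S^{n-1}}|h_K(u)-h_L(u)|$ is the Hausdorff distance. For $0<t\le 2$ and $u\in S^{n-1}$ let $C_t(u)=\{v\in S^{n-1}:\|u-v\|<t\}$. A sequence $(u_i)$ in $S^{n-1}$ is evenly spread if for all $0<t<2$ there are a constant $c=c(t)>0$ and an $N=N(t)$ such that $|\{u_1,\dots,u_k\}\cap C_t(u)|\ge ck$ for all $u\in S^{n-1}$ and $k\ge N$. Algorithm NoisySupportLSQ. Input: natural numbers $n\ge2$ and $k\ge n+1$; vectors $u_1,\dots,u_k\in S^{n-1}$ whose positive hull is $\mathbb{R}^n$; noisy support function measurements $y_i=h_K(u_i)+X_i$, $i=1,\dots,k$, of an unknown convex body $K$ in $\mathbb{R}^n$, where the $X_i$'s are independent normal $N(0,\sigma^2)$ random variables. Nonnegative real numbers $h_1,\dots,h_k$ are called consistent if there is a compact convex set $L$ in $\mathbb{R}^n$ with $h_L(u_i)=h_i$, $i=1,\dots,k$. Let $\hat h_1,\dots,\hat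 h_k$ be a solution of the problem of minimizing $\sum_{i=1}^k(y_i-h_i)^2$ over $h_1,\dots,h_k$ subject to $h_1,\dots,h_k$ being consistent. The output is the polytope $\hat P_k=\bigcap_{i=1}^k\{x\in\mathbb{R}^n:x\cdot u_i\le\hat h_i\}$. An evenly spread sequence is dense in $S^{n-1}$, so the positive hull of $u_1,\dots,u_k$ is $\mathbb{R}^n$, and the algorithm produces an output, for all sufficiently large $k$.
   Formalization: With nonnegative ĥ_i the claim is false when 0 is not in K (every output then contains 0), so it is proved for the algorithm with nonnegative ĥ_i when 0 lies in K, and for arbitrary K when consistent values may be arbitrary real numbers. *)

theory Defs
  imports "HOL-Probability.Probability"
begin

definition convex_body :: "'a::euclidean_space set \<Rightarrow> bool" where
  "convex_body K \<longleftrightarrow> compact K \<and> convex K \<and> interior K \<noteq> {}"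

(* Intended for nonempty compact convex L, where the supremum is a maximum. *)
definition support_fn :: "'a::euclidean_space set \<Rightarrow> 'a \<Rightarrow> real" where
  "support_fn L x = (SUP y\<in>L. x \<bullet> y)"

(* The Hausdorff distance of nonempty compact convex sets. *)
definition hausdorff_delta :: "'a::euclidean_space set \<Rightarrow> 'a set \<Rightarrow> real" where
  "hausdorff_delta K L = (SUP v\<in>sphere 0 1. \<bar>support_fn K v - support_fn L v\<bar>)"

definition cap :: "real \<Rightarrow> 'a::euclidean_space \<Rightarrow> 'a set" where
  "cap t w = {v \<in> sphere 0 1. norm (w - v) < t}"

(* All sequences are indexed from 1.  The set of the first k directions is counted,
   so a repeated direction counts once. *)
definition evenly_spread :: "(nat \<Rightarrow> 'a::euclidean_space) \<Rightarrow> bool" where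
  "evenly_spread u \<longleftrightarrow>
     (\<forall>i\<ge>1. u i \<in> sphere 0 1) \<and>
     (\<forall>t. 0 < t \<and> t < 2 \<longrightarrow>
        (\<exists>c>0. \<exists>N. \<forall>w\<in>sphere 0 1. \<forall>k\<ge>N. real (card (u ` {1..k} \<inter> cap t w)) \<ge> c * real k))"

definition positive_hull :: "(nat \<Rightarrow> 'a::euclidean_space) \<Rightarrow> nat \<Rightarrow> 'a set" where
  "positive_hull u k = {(\<Sum>i=1..k. c i *\<^sub>R u i) | c. \<forall>i\<in>{1..k}. (c i :: real) \<ge> 0}"

(* R is the set of values allowed for the h i: {0..} if only nonnegative numbers are
   admitted, UNIV if arbitrary real numbers are.  With {0..}, every output of the least
   squares problem below contains the origin, so it can only approximate bodies that do. *)
definition consistent :: "real set \<Rightarrow> (nat \<Rightarrow> 'a::euclidean_space) \<Rightarrow> nat \<Rightarrow> (nat \<Rightarrow> real) \<Rightarrow> bool" where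
  "consistent R u k h \<longleftrightarrow>
     (\<forall>i\<in>{1..k}. h i \<in> R) \<and>
     (\<exists>L. compact L \<and> convex L \<and> L \<noteq> {} \<and> (\<forall>i\<in>{1..k}. support_fn L (u i) = h i))"

definition noisy_support_lsq_input :: "(nat \<Rightarrow> 'a::euclidean_space) \<Rightarrow> nat \<Rightarrow> bool" where
  "noisy_support_lsq_input u k \<longleftrightarrow>
     DIM('a) \<ge> 2 \<and> k \<ge> DIM('a) + 1 \<and> (\<forall>i\<in>{1..k}. u i \<in> sphere 0 1) \<and> positive_hull u k = UNIV"

(* P is an output for the directions u 1, ..., u k and the measurements y 1, ..., y k. *)
definition noisy_support_lsq_output ::
  "real set \<Rightarrow> (nat \<Rightarrow> 'a::euclidean_space) \<Rightarrow> (nat \<Rightarrow> real) \<Rightarrow> nat \<Rightarrow> 'a set \<Rightarrow> bool" where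
  "noisy_support_lsq_output R u y k P \<longleftrightarrow>
     (\<exists>h. is_arg_min (\<lambda>h. \<Sum>i=1..k. (y i - h i)\<^sup>2) (consistent R u k) h \<and>
          P = (\<Inter>i\<in>{1..k}. {x. x \<bullet> u i \<le> h i}))"

end

theory Submission
  imports Defs
begin

text \<open>Write \<open>x i\<close> for the noise values at a fixed sample point and \<open>d i\<close> for the error
\<open>h i - support_fn K (u i)\<close> of a least squares solution \<open>h\<close>. For large \<open>k\<close> the directions form an
admissible input (\<open>eventually_noisy_support_lsq_input\<close>). As \<open>h\<close> is consistent, it is the
restriction of the support function of the output polytope once that polytope is known to be
bounded. The values of \<open>K\<close> are consistent as well, so comparing the two residuals gives the basic
inequality
\<open>(\<Sum>i\<le>k. (d i)\<^sup>2) \<le> 2 * (\<Sum>i\<le>k. x i * d i)\<close>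
(\<open>lsq_output_cases\<close>). Everything follows from it and three facts.

First, evenly spread directions turn averages into pointwise statements: if \<open>\<bar>d i\<bar> \<ge> a \<ge> 0\<close> for
all directions in some cap of radius \<open>t\<close>, then \<open>(\<Sum>i\<le>k. (d i)\<^sup>2) \<ge> c * k * a\<^sup>2\<close>
for large \<open>k\<close>, with \<open>c\<close> depending only on \<open>t\<close> (\<open>evenly_spread_sum_squares\<close>). The basic inequality and Young's inequality bound the
mean square error by four times the mean square noise, which stays bounded almost surely. A point
\<open>z\<close> of the polytope of large norm would make all errors near the direction of \<open>z\<close> large, so
the polytopes eventually lie in one ball (\<open>lsq_outputs_bounded\<close>). The differences
\<open>f k = support_fn (P k) - support_fn K\<close> are then Lipschitz with a common constant.

Second, the law of large numbers holds uniformly over such Lipschitz functions: a partition of the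
sphere into finitely many small cells replaces \<open>f k\<close> by a step function, whose noise average is
at most a constant times the sum of the absolute noise averages over the cells (\<open>weighted_sum_Lipschitz_le\<close>). These cells
do not depend on \<open>f k\<close>, so it suffices that finitely many averages tend to zero for each of
countably many mesh sizes. Hence the mean square error tends to zero; by the Lipschitz
bound and the cap estimate again, \<open>f k\<close> tends to zero uniformly (\<open>lsq_outputs_converge\<close>).

Third, both statements on the noise come from one exponential-moment argument
(\<open>AE_eventually_sum_nonpos\<close>): products of independent factors of mean at most \<open>\<rho> < 1\<close> have
summable expectations, so they tend to zero almost surely. For normal noise the required moments are
computed by recognising a multiple of another normal density.\<close>

section \<open>Almost sure bounds on averages of normal noise\<close>

text \<open>A Chernoff bound and a Borel--Cantelli argument in one: by independence \<open>exp\<close> of the \<open>k\<close>-th partial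
sum has expectation at most \<open>\<rho> ^ k\<close>. The expected sum over all \<open>k\<close> is therefore finite, so
almost surely these exponentials are summable, hence eventually below \<open>1\<close>.\<close>
lemma (in prob_space) AE_eventually_sum_nonpos:
  fixes X :: "nat \<Rightarrow> 'a \<Rightarrow> real" and g :: "nat \<Rightarrow> real \<Rightarrow> real"
  assumes indep: "indep_vars (\<lambda>_. borel) X {1..}"
    and g: "\<And>i. g i \<in> borel_measurable borel"
    and exp_le: "\<And>i. i \<ge> 1 \<Longrightarrow> (\<integral>\<^sup>+\<omega>. ennreal (exp (g i (X i \<omega>))) \<partial>M) \<le> ennreal \<rho>"
    and \<rho>: "0 \<le> \<rho>" "\<rho> < 1"
  shows "AE \<omega> in M. \<forall>\<^sub>F k in sequentially. (\<Sum>i=1..k. g i (X i \<omega>)) \<le> 0"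
proof -
  note [measurable] = g
  define Z where "Z k \<omega> = exp (\<Sum>i=1..k. g i (X i \<omega>))" for k \<omega>
  have [measurable]: "X i \<in> borel_measurable M" if "i \<ge> 1" for i
    using indep that unfolding indep_vars_def by auto
  have [measurable]: "Z k \<in> borel_measurable M" for k
    unfolding Z_def by measurable
  have Z_le: "(\<integral>\<^sup>+\<omega>. ennreal (Z k \<omega>) \<partial>M) \<le> ennreal (\<rho> ^ k)" for k
  proof -
    have "indep_vars (\<lambda>_. borel) (\<lambda>i \<omega>. ennreal (exp (g i (X i \<omega>)))) {1..k}"
      by (rule indep_vars_compose2[where Y = "\<lambda>i x. ennreal (exp (g i x))", OF indep_vars_subset[OF indep]])
        auto
    moreover have "ennreal (Z k \<omega>) = (\<Prod>i=1..k. ennreal (exp (g i (X i \<omega>))))" for \<omega>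
      by (simp add: Z_def exp_sum prod_ennreal)
    ultimately have "(\<integral>\<^sup>+\<omega>. ennreal (Z k \<omega>) \<partial>M)
        = (\<Prod>i=1..k. \<integral>\<^sup>+\<omega>. ennreal (exp (g i (X i \<omega>))) \<partial>M)"
      by (simp add: indep_vars_nn_integral)
    also have "\<dots> \<le> (\<Prod>i=1..k. ennreal \<rho>)"
      by (rule prod_mono_ennreal) (auto intro: exp_le)
    also have "\<dots> = ennreal (\<rho> ^ k)"
      using \<rho> by (simp add: ennreal_power)
    finally show ?thesis .
  qed
  have "(\<integral>\<^sup>+\<omega>. (\<Sum>k. ennreal (Z k \<omega>)) \<partial>M) = (\<Sum>k. \<integral>\<^sup>+\<omega>. ennreal (Z k \<omega>) \<partial>M)"
    by (rule nn_integral_suminf) measurable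
  also have "\<dots> \<le> (\<Sum>k. ennreal (\<rho> ^ k))"
    by (intro suminf_le Z_le) auto
  also have "\<dots> = ennreal (\<Sum>k. \<rho> ^ k)"
    using \<rho> by (intro suminf_ennreal2 summable_geometric) auto
  finally have "(\<integral>\<^sup>+\<omega>. (\<Sum>k. ennreal (Z k \<omega>)) \<partial>M) \<noteq> \<infinity>"
    by (auto simp: top_unique)
  then have "AE \<omega> in M. (\<Sum>k. ennreal (Z k \<omega>)) \<noteq> \<infinity>"
    by (intro nn_integral_noteq_infinite) measurable
  then show ?thesis
  proof (rule AE_mp[OF _ AE_I2], intro impI)
    fix \<omega> assume "(\<Sum>k. ennreal (Z k \<omega>)) \<noteq> \<infinity>"
    then have "summable (\<lambda>k. Z k \<omega>)"
      by (intro summable_suminf_not_top) (auto simp: Z_def)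
    then have "(\<lambda>k. Z k \<omega>) \<longlonglongrightarrow> 0"
      by (rule summable_LIMSEQ_zero)
    then have "\<forall>\<^sub>F k in sequentially. Z k \<omega> < 1"
      by (rule order_tendstoD) simp
    then show "\<forall>\<^sub>F k in sequentially. (\<Sum>i=1..k. g i (X i \<omega>)) \<le> 0"
      by eventually_elim (simp add: Z_def)
  qed
qed

text \<open>Exponentials of linear and of small quadratic functions map a centred normal density to a multiple
\<open>a\<close> of another normal density; as that density integrates to \<open>1\<close>, the multiple is the moment.\<close>
lemma (in prob_space) nn_integral_exp_of_tilted_normal:
  assumes "distributed M lborel X (normal_density 0 \<sigma>)" "0 < \<tau>"
    and [measurable]: "g \<in> borel_measurable borel"
    and tilt: "\<And>x. normal_density 0 \<sigma> x * exp (g x) = a * normal_density \<mu> \<tau> x" and "0 \<le> a"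
  shows "(\<integral>\<^sup>+\<omega>. ennreal (exp (g (X \<omega>))) \<partial>M) = ennreal a"
proof -
  have "(\<integral>\<^sup>+\<omega>. ennreal (exp (g (X \<omega>))) \<partial>M)
      = (\<integral>\<^sup>+x. ennreal (normal_density 0 \<sigma> x) * ennreal (exp (g x)) \<partial>lborel)"
    by (rule distributed_nn_integral[OF assms(1), symmetric]) measurable
  also have "\<dots> = (\<integral>\<^sup>+x. ennreal a * ennreal (normal_density \<mu> \<tau> x) \<partial>lborel)"
    by (intro nn_integral_cong)
      (use \<open>0 \<le> a\<close> in \<open>simp add: ennreal_mult[symmetric] normal_density_nonneg tilt\<close>)
  also have "\<dots> = ennreal a * (\<integral>\<^sup>+x. ennreal (normal_density \<mu> \<tau> x) \<partial>lborel)"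
    by (rule nn_integral_cmult) measurable
  also have "(\<integral>\<^sup>+x. ennreal (normal_density \<mu> \<tau> x) \<partial>lborel) = 1"
    using \<open>0 < \<tau>\<close> by (simp add: nn_integral_eq_integral normal_density_nonneg)
  finally show ?thesis by simp
qed

lemma (in prob_space) nn_integral_exp_normal:
  assumes "distributed M lborel X (normal_density 0 \<sigma>)" "0 < \<sigma>"
  shows "(\<integral>\<^sup>+\<omega>. ennreal (exp (s * X \<omega> - b)) \<partial>M) = ennreal (exp (\<sigma>\<^sup>2 * s\<^sup>2 / 2 - b))"
proof (rule nn_integral_exp_of_tilted_normal[OF assms, where \<mu> = "\<sigma>\<^sup>2 * s"])
  show "normal_density 0 \<sigma> x * exp (s * x - b)
      = exp (\<sigma>\<^sup>2 * s\<^sup>2 / 2 - b) * normal_density (\<sigma>\<^sup>2 * s) \<sigma> x" for x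
  proof -
    have "- (x - 0)\<^sup>2 / (2 * \<sigma>\<^sup>2) + (s * x - b)
        = (\<sigma>\<^sup>2 * s\<^sup>2 / 2 - b) + - (x - \<sigma>\<^sup>2 * s)\<^sup>2 / (2 * \<sigma>\<^sup>2)"
      using \<open>0 < \<sigma>\<close> by (simp add: field_simps power2_eq_square)
    then show ?thesis
      unfolding normal_density_def by (simp add: exp_add[symmetric] del: exp_add)
  qed
qed auto

lemma (in prob_space) nn_integral_exp_normal_square:
  assumes "distributed M lborel X (normal_density 0 \<sigma>)" "0 < \<sigma>"
  shows "(\<integral>\<^sup>+\<omega>. ennreal (exp ((X \<omega>)\<^sup>2 / (4 * \<sigma>\<^sup>2) - ln 2)) \<partial>M) = ennreal (sqrt 2 / 2)"
proof (rule nn_integral_exp_of_tilted_normal[OF assms(1), where \<mu> = 0 and \<tau> = "sqrt 2 * \<sigma>"])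
  show "normal_density 0 \<sigma> x * exp (x\<^sup>2 / (4 * \<sigma>\<^sup>2) - ln 2)
      = sqrt 2 / 2 * normal_density 0 (sqrt 2 * \<sigma>) x" for x
  proof -
    have "- x\<^sup>2 / (2 * \<sigma>\<^sup>2) + x\<^sup>2 / (4 * \<sigma>\<^sup>2) = - x\<^sup>2 / (2 * (2 * \<sigma>\<^sup>2))"
      using \<open>0 < \<sigma>\<close> by (simp add: field_simps)
    then have exps: "exp (- x\<^sup>2 / (2 * \<sigma>\<^sup>2)) * exp (x\<^sup>2 / (4 * \<sigma>\<^sup>2)) = exp (- x\<^sup>2 / (2 * (2 * \<sigma>\<^sup>2)))"
      by (simp only: exp_add[symmetric])
    have "normal_density 0 \<sigma> x * exp (x\<^sup>2 / (4 * \<sigma>\<^sup>2) - ln 2)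
        = 1 / sqrt (2 * pi * \<sigma>\<^sup>2) / 2 * (exp (- x\<^sup>2 / (2 * \<sigma>\<^sup>2)) * exp (x\<^sup>2 / (4 * \<sigma>\<^sup>2)))"
      by (simp add: normal_density_def exp_diff)
    also have "1 / sqrt (2 * pi * \<sigma>\<^sup>2) / 2 = sqrt 2 / 2 * (1 / sqrt (2 * pi * (sqrt 2 * \<sigma>)\<^sup>2))"
    proof -
      have "2 * pi * (sqrt 2 * \<sigma>)\<^sup>2 = 2 * (2 * pi * \<sigma>\<^sup>2)"
        by (simp add: power_mult_distrib)
      then have "sqrt (2 * pi * (sqrt 2 * \<sigma>)\<^sup>2) = sqrt 2 * sqrt (2 * pi * \<sigma>\<^sup>2)"
        by (simp only: real_sqrt_mult)
      then show ?thesis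
        by simp
    qed
    also have "\<dots> * (exp (- x\<^sup>2 / (2 * \<sigma>\<^sup>2)) * exp (x\<^sup>2 / (4 * \<sigma>\<^sup>2)))
        = sqrt 2 / 2 * normal_density 0 (sqrt 2 * \<sigma>) x"
      unfolding exps by (simp add: normal_density_def power_mult_distrib)
    finally show ?thesis .
  qed
qed (use \<open>0 < \<sigma>\<close> in auto)

text \<open>With the exponent \<open>x\<^sup>2 / (4 * \<sigma>\<^sup>2)\<close> the moment of a single square is \<open>sqrt 2\<close>, so
subtracting \<open>ln 2\<close> per summand makes the factors \<open>sqrt 2 / 2 < 1\<close>.\<close>
lemma (in prob_space) AE_normal_squares_bounded_average:
  assumes "indep_vars (\<lambda>_. borel) X {1..}"
    and "\<And>i. i \<ge> 1 \<Longrightarrow> distributed M lborel (X i) (normal_density 0 \<sigma>)" and "\<sigma> > 0"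
  shows "AE \<omega> in M. \<forall>\<^sub>F k in sequentially. (\<Sum>i=1..k. (X i \<omega>)\<^sup>2) \<le> 4 * \<sigma>\<^sup>2 * ln 2 * real k"
proof -
  have "sqrt 2 / 2 < (1::real)"
    using sqrt2_less_2 by simp
  then have "AE \<omega> in M. \<forall>\<^sub>F k in sequentially. (\<Sum>i=1..k. (X i \<omega>)\<^sup>2 / (4 * \<sigma>\<^sup>2) - ln 2) \<le> 0"
    using assms
    by (intro AE_eventually_sum_nonpos[where g = "\<lambda>_ x. x\<^sup>2 / (4 * \<sigma>\<^sup>2) - ln 2" and \<rho> = "sqrt 2 / 2"])
      (auto simp: nn_integral_exp_normal_square)
  then show ?thesis
  proof (rule AE_mp[OF _ AE_I2], intro impI)
    fix \<omega> assume "\<forall>\<^sub>F k in sequentially. (\<Sum>i=1..k. (X i \<omega>)\<^sup>2 / (4 * \<sigma>\<^sup>2) - ln 2) \<le> 0"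
    then show "\<forall>\<^sub>F k in sequentially. (\<Sum>i=1..k. (X i \<omega>)\<^sup>2) \<le> 4 * \<sigma>\<^sup>2 * ln 2 * real k"
      by eventually_elim
        (use \<open>\<sigma> > 0\<close> in \<open>simp add: sum_subtractf sum_divide_distrib[symmetric] field_simps\<close>)
  qed
qed

text \<open>The weights serve to restrict the average to the indices whose direction lies in a given cell.\<close>
lemma (in prob_space) AE_weighted_normal_average_null:
  assumes indep: "indep_vars (\<lambda>_. borel) X {1..}"
    and normal: "\<And>i. i \<ge> 1 \<Longrightarrow> distributed M lborel (X i) (normal_density 0 \<sigma>)" and "\<sigma> > 0"
    and b: "\<And>i. \<bar>b i\<bar> \<le> 1"
  shows "AE \<omega> in M. (\<lambda>k. (\<Sum>i=1..k. b i * X i \<omega>) / real k) \<longlonglongrightarrow> 0"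
proof -
  have upper: "AE \<omega> in M. \<forall>\<^sub>F k in sequentially. (\<Sum>i=1..k. a i * X i \<omega>) \<le> \<delta> * real k"
    if a: "\<And>i. \<bar>a i\<bar> \<le> 1" and "\<delta> > 0" for a :: "nat \<Rightarrow> real" and \<delta>
  proof -
    \<comment> \<open>This \<open>t\<close> minimises the exponent \<open>\<sigma>\<^sup>2 * t\<^sup>2 / 2 - t * \<delta>\<close> of the Chernoff bound.\<close>
    define t where "t = \<delta> / \<sigma>\<^sup>2"
    have "t > 0"
      using \<open>\<sigma> > 0\<close> \<open>\<delta> > 0\<close> by (simp add: t_def)
    have "(\<integral>\<^sup>+\<omega>. ennreal (exp (t * a i * X i \<omega> - t * \<delta>)) \<partial>M) \<le> ennreal (exp (- \<delta>\<^sup>2 / (2 * \<sigma>\<^sup>2)))"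
      if "i \<ge> 1" for i
    proof -
      have "(a i)\<^sup>2 \<le> 1"
        using a by (simp add: abs_square_le_1)
      then have "\<sigma>\<^sup>2 * t\<^sup>2 / 2 * (a i)\<^sup>2 \<le> \<sigma>\<^sup>2 * t\<^sup>2 / 2"
        by (simp add: mult_left_le)
      moreover have "\<sigma>\<^sup>2 * t\<^sup>2 / 2 - t * \<delta> = - \<delta>\<^sup>2 / (2 * \<sigma>\<^sup>2)"
        using \<open>\<sigma> > 0\<close> by (simp add: t_def field_simps power2_eq_square)
      ultimately have "\<sigma>\<^sup>2 * (t * a i)\<^sup>2 / 2 - t * \<delta> \<le> - \<delta>\<^sup>2 / (2 * \<sigma>\<^sup>2)"
        by (simp add: power_mult_distrib)
      then show ?thesis
        by (simp only: nn_integral_exp_normal[OF normal[OF that] \<open>\<sigma> > 0\<close>] ennreal_leI exp_le_cancel_iff)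
    qed
    moreover have "exp (- \<delta>\<^sup>2 / (2 * \<sigma>\<^sup>2)) < 1"
      using \<open>\<sigma> > 0\<close> \<open>\<delta> > 0\<close> by simp
    ultimately have "AE \<omega> in M. \<forall>\<^sub>F k in sequentially. (\<Sum>i=1..k. t * a i * X i \<omega> - t * \<delta>) \<le> 0"
      by (intro AE_eventually_sum_nonpos[where g = "\<lambda>i x. t * a i * x - t * \<delta>"
              and \<rho> = "exp (- \<delta>\<^sup>2 / (2 * \<sigma>\<^sup>2))", OF indep]) auto
    then show ?thesis
    proof (rule AE_mp[OF _ AE_I2], intro impI)
      fix \<omega> assume "\<forall>\<^sub>F k in sequentially. (\<Sum>i=1..k. t * a i * X i \<omega> - t * \<delta>) \<le> 0"
      then show "\<forall>\<^sub>F k in sequentially. (\<Sum>i=1..k. a i * X i \<omega>) \<le> \<delta> * real k"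
      proof eventually_elim
        case (elim k)
        then have "t * ((\<Sum>i=1..k. a i * X i \<omega>) - \<delta> * real k) \<le> 0"
          by (simp add: sum_subtractf sum_distrib_left algebra_simps)
        with \<open>t > 0\<close> show ?case
          by (simp add: mult_le_0_iff)
      qed
    qed
  qed
  have "AE \<omega> in M. \<forall>m. \<forall>\<^sub>F k in sequentially.
      \<bar>\<Sum>i=1..k. b i * X i \<omega>\<bar> \<le> inverse (real (Suc m)) * real k"
  proof (subst AE_all_countable, intro allI)
    fix m
    have "AE \<omega> in M. (\<forall>\<^sub>F k in sequentially. (\<Sum>i=1..k. b i * X i \<omega>) \<le> inverse (real (Suc m)) * real k)
        \<and> (\<forall>\<^sub>F k in sequentially. (\<Sum>i=1..k. - b i * X i \<omega>) \<le> inverse (real (Suc m)) * real k)"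
      using b by (intro AE_conjI upper) auto
    then show "AE \<omega> in M. \<forall>\<^sub>F k in sequentially.
      \<bar>\<Sum>i=1..k. b i * X i \<omega>\<bar> \<le> inverse (real (Suc m)) * real k"
      by (rule AE_mp[OF _ AE_I2]) (auto elim: eventually_elim2 simp: sum_negf)
  qed
  then show ?thesis
  proof (rule AE_mp[OF _ AE_I2], intro impI)
    fix \<omega> assume small: "\<forall>m. \<forall>\<^sub>F k in sequentially.
      \<bar>\<Sum>i=1..k. b i * X i \<omega>\<bar> \<le> inverse (real (Suc m)) * real k"
    show "(\<lambda>k. (\<Sum>i=1..k. b i * X i \<omega>) / real k) \<longlonglongrightarrow> 0"
    proof (rule tendstoI)
      fix \<epsilon> :: real assume "\<epsilon> > 0"
      then obtain m where m: "inverse (real (Suc m)) < \<epsilon>"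
        using reals_Archimedean by blast
      show "\<forall>\<^sub>F k in sequentially. dist ((\<Sum>i=1..k. b i * X i \<omega>) / real k) 0 < \<epsilon>"
        using small[rule_format, of m] eventually_gt_at_top[of 0]
      proof eventually_elim
        case (elim k)
        then have "\<bar>\<Sum>i=1..k. b i * X i \<omega>\<bar> / real k \<le> inverse (real (Suc m))"
          by (simp add: divide_le_eq)
        with m show ?case
          by simp
      qed
    qed
  qed
qed

section \<open>Support functions\<close>

lemma support_fn_upper:
  assumes "bounded L" "y \<in> L"
  shows "v \<bullet> y \<le> support_fn L v"
  unfolding support_fn_def
proof (rule cSUP_upper[OF \<open>y \<in> L\<close>])
  obtain r where "\<forall>y\<in>L. norm y \<le> r"
    using \<open>bounded L\<close> by (auto simp: bounded_iff)
  then show "bdd_above ((\<bullet>) v ` L)"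
    by (intro bdd_aboveI2[where M = "norm v * r"])
      (meson mult_left_mono norm_cauchy_schwarz norm_ge_zero order_trans)
qed

lemma support_fn_least:
  assumes "L \<noteq> {}" "\<And>y. y \<in> L \<Longrightarrow> v \<bullet> y \<le> b"
  shows "support_fn L v \<le> b"
  unfolding support_fn_def using assms by (rule cSUP_least)

lemma support_fn_Lipschitz:
  assumes "L \<noteq> {}" "L \<subseteq> cball 0 r"
  shows "\<bar>support_fn L v - support_fn L w\<bar> \<le> r * norm (v - w)"
proof -
  have bounded: "bounded L"
    using assms(2) bounded_cball bounded_subset by blast
  have "support_fn L v \<le> support_fn L w + r * norm (v - w)" for v w
  proof (rule support_fn_least[OF \<open>L \<noteq> {}\<close>])
    fix y assume "y \<in> L"
    have "v \<bullet> y = w \<bullet> y + (v - w) \<bullet> y"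
      by (simp add: inner_diff_left)
    also have "(v - w) \<bullet> y \<le> norm (v - w) * norm y"
      by (rule norm_cauchy_schwarz)
    also have "\<dots> \<le> norm (v - w) * r"
      using assms(2) \<open>y \<in> L\<close> by (intro mult_left_mono) auto
    finally show "v \<bullet> y \<le> support_fn L w + r * norm (v - w)"
      using support_fn_upper[OF bounded \<open>y \<in> L\<close>, of w] by (simp add: mult.commute)
  qed
  from this[of v w] this[of w v] show ?thesis
    by (simp add: norm_minus_commute abs_le_iff)
qed

lemma support_fn_abs_le:
  assumes "L \<noteq> {}" "L \<subseteq> cball 0 r"
  shows "\<bar>support_fn L v\<bar> \<le> r * norm v"
  using support_fn_Lipschitz[OF assms, of v 0] \<open>L \<noteq> {}\<close> by (simp add: support_fn_def)

section \<open>Evenly spread directions\<close>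

text \<open>This is the only way in which the counting condition enters: an error that is large throughout a
cap contributes a fixed proportion of the indices to the sum of squares. Distinct directions are
counted, which bounds the number of indices from below.\<close>
lemma evenly_spread_sum_squares:
  assumes "evenly_spread u" "0 < t" "t < 2"
  obtains c where "c > 0"
    "\<forall>\<^sub>F k in sequentially. \<forall>w\<in>sphere 0 1. \<forall>d a. 0 \<le> a \<longrightarrow>
       (\<forall>i\<in>{1..k}. u i \<in> cap t w \<longrightarrow> a \<le> \<bar>d i\<bar>) \<longrightarrow> c * real k * a\<^sup>2 \<le> (\<Sum>i=1..k. (d i)\<^sup>2)"
proof -
  obtain c N where "c > 0"
    and N: "\<And>w k. w \<in> sphere 0 1 \<Longrightarrow> k \<ge> N \<Longrightarrow> real (card (u ` {1..k} \<inter> cap t w)) \<ge> c * real k"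
    using assms unfolding evenly_spread_def by metis
  have "c * real k * a\<^sup>2 \<le> (\<Sum>i=1..k. (d i)\<^sup>2)"
    if "k \<ge> N" "w \<in> sphere 0 1" "0 \<le> a"
      and large: "\<forall>i\<in>{1..k}. u i \<in> cap t w \<longrightarrow> a \<le> \<bar>d i\<bar>" for k w a and d :: "nat \<Rightarrow> real"
  proof -
    define I where "I = {i \<in> {1..k}. u i \<in> cap t w}"
    have "u ` {1..k} \<inter> cap t w = u ` I"
      by (auto simp: I_def)
    then have "card (u ` {1..k} \<inter> cap t w) \<le> card I"
      by (simp add: I_def card_image_le)
    then have "c * real k \<le> real (card I)"
      using N[OF that(2,1)] by linarith
    then have "c * real k * a\<^sup>2 \<le> real (card I) * a\<^sup>2"
      by (rule mult_right_mono) simp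
    also have "\<dots> = (\<Sum>i\<in>I. a\<^sup>2)"
      by simp
    also have "\<dots> \<le> (\<Sum>i\<in>I. (d i)\<^sup>2)"
      using large \<open>0 \<le> a\<close> by (intro sum_mono) (auto simp: I_def abs_le_square_iff[symmetric])
    also have "\<dots> \<le> (\<Sum>i=1..k. (d i)\<^sup>2)"
      by (intro sum_mono2) (auto simp: I_def)
    finally show ?thesis .
  qed
  then show thesis
    using \<open>c > 0\<close> by (intro that[of c]) (auto intro: eventually_sequentiallyI[of N])
qed

text \<open>If a cap contained none of the directions, the previous estimate would apply to the zero sequence
with \<open>a = 1\<close>, because its premise is vacuous, and give \<open>c * k \<le> 0\<close>.\<close>
lemma evenly_spread_meets_caps:
  assumes "evenly_spread u" "0 < t" "t < 2"
  shows "\<forall>\<^sub>F k in sequentially. \<forall>w\<in>sphere 0 1. \<exists>i\<in>{1..k}. u i \<in> cap t w"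
proof -
  obtain c where "c > 0" and c: "\<forall>\<^sub>F k in sequentially. \<forall>w\<in>sphere 0 1. \<forall>d a. 0 \<le> a \<longrightarrow>
       (\<forall>i\<in>{1..k}. u i \<in> cap t w \<longrightarrow> a \<le> \<bar>d i\<bar>) \<longrightarrow> c * real k * a\<^sup>2 \<le> (\<Sum>i=1..k. (d i)\<^sup>2)"
    by (rule evenly_spread_sum_squares[OF assms]) (rule that)
  show ?thesis
    using c eventually_gt_at_top[of 0]
  proof eventually_elim
    case (elim k)
    show ?case
    proof (rule ballI, rule ccontr)
      fix w :: 'a assume "w \<in> sphere 0 1" "\<not> (\<exists>i\<in>{1..k}. u i \<in> cap t w)"
      then have "c * real k \<le> 0"
        using elim(1)[rule_format, of w 1 "\<lambda>_. 0"] by auto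
      with \<open>c > 0\<close> \<open>k > 0\<close> show False
        by (simp add: mult_le_0_iff)
    qed
  qed
qed

lemma inner_gt_half_of_cap:
  assumes "w \<in> sphere 0 1" "v \<in> cap 1 w"
  shows "w \<bullet> v > 1 / 2"
proof -
  have "(norm (w - v))\<^sup>2 < 1"
    using assms by (simp add: cap_def abs_square_less_1)
  moreover have "(norm (w - v))\<^sup>2 = 2 - 2 * (w \<bullet> v)"
    using assms by (simp add: cap_def norm_eq_1 power2_norm_eq_inner inner_diff_left inner_diff_right
        inner_commute)
  ultimately show ?thesis
    by simp
qed

lemma convex_positive_hull: "convex (positive_hull u k)"
proof (rule convexI)
  fix x y and a b :: real
  assume "x \<in> positive_hull u k" "y \<in> positive_hull u k" "0 \<le> a" "0 \<le> b"
  then obtain c d where "\<forall>i\<in>{1..k}. 0 \<le> c i" "x = (\<Sum>i=1..k. c i *\<^sub>R u i)"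
    "\<forall>i\<in>{1..k}. 0 \<le> d i" "y = (\<Sum>i=1..k. d i *\<^sub>R u i)"
    unfolding positive_hull_def by auto
  then have "\<forall>i\<in>{1..k}. 0 \<le> a * c i + b * d i"
    "a *\<^sub>R x + b *\<^sub>R y = (\<Sum>i=1..k. (a * c i + b * d i) *\<^sub>R u i)"
    using \<open>0 \<le> a\<close> \<open>0 \<le> b\<close> by (auto simp: scaleR_sum_right scaleR_add_left sum.distrib)
  then show "a *\<^sub>R x + b *\<^sub>R y \<in> positive_hull u k"
    unfolding positive_hull_def by (intro CollectI exI[of _ "\<lambda>i. a * c i + b * d i"]) auto
qed

lemma scaleR_generator_in_positive_hull:
  assumes "i \<in> {1..k}" "0 \<le> s"
  shows "s *\<^sub>R u i \<in> positive_hull u k"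
proof -
  have "(\<Sum>j=1..k. (if j = i then s else 0) *\<^sub>R u j) = s *\<^sub>R u i"
    using assms(1) by (simp add: if_distrib[of "\<lambda>c. c *\<^sub>R _"] cong: if_cong)
  then show ?thesis
    using \<open>0 \<le> s\<close> unfolding positive_hull_def
    by (intro CollectI exI[of _ "\<lambda>j. if j = i then s else 0"]) auto
qed

text \<open>Otherwise a hyperplane separates the positive hull from a point. Since the hull is a cone, its
normal \<open>a\<close> satisfies \<open>a \<bullet> u i \<le> 0\<close> for all \<open>i\<close>, while some direction lies in the cap
around \<open>a / norm a\<close> and has a positive inner product with \<open>a\<close>.\<close>
lemma positive_hull_eq_UNIV:
  assumes caps: "\<forall>w\<in>sphere 0 1. \<exists>i\<in>{1..k}. u i \<in> cap 1 w"
  shows "positive_hull u k = UNIV"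
proof (rule ccontr)
  assume "positive_hull u k \<noteq> UNIV"
  then obtain z where "z \<notin> positive_hull u k"
    by blast
  moreover have "0 \<in> positive_hull u k"
    unfolding positive_hull_def by (auto intro: exI[of _ "\<lambda>_. 0"])
  ultimately obtain a b where "a \<noteq> 0" and b: "\<forall>x\<in>positive_hull u k. a \<bullet> x \<le> b"
    using separating_hyperplane_sets[OF convex_positive_hull[of u k] convex_singleton[of z]] by auto
  define w where "w = a /\<^sub>R norm a"
  have "w \<in> sphere 0 1"
    using \<open>a \<noteq> 0\<close> by (simp add: w_def)
  then obtain i where i: "i \<in> {1..k}" "w \<bullet> u i > 1 / 2"
    using caps inner_gt_half_of_cap by blast
  have "a \<bullet> u i = norm a * (w \<bullet> u i)"
    using \<open>a \<noteq> 0\<close> by (simp add: w_def)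
  with i(2) have "a \<bullet> u i > 0"
    using \<open>a \<noteq> 0\<close> by (simp add: zero_less_mult_iff)
  moreover have "a \<bullet> (s *\<^sub>R u i) \<le> b" if "0 \<le> s" for s
    using b scaleR_generator_in_positive_hull[OF i(1) that] by blast
  \<comment> \<open>Moving far along the ray through \<open>u i\<close> exceeds the separating level.\<close>
  from this[of "(\<bar>b\<bar> + 1) / (a \<bullet> u i)"] have "\<bar>b\<bar> + 1 \<le> b"
    using \<open>a \<bullet> u i > 0\<close> by simp
  ultimately show False
    by simp
qed

lemma eventually_noisy_support_lsq_input:
  fixes u :: "nat \<Rightarrow> 'a::euclidean_space"
  assumes "DIM('a) \<ge> 2" "evenly_spread u"
  shows "\<forall>\<^sub>F k in sequentially. noisy_support_lsq_input u k"
proof -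
  have "\<forall>\<^sub>F k in sequentially. \<forall>w\<in>sphere 0 1. \<exists>i\<in>{1..k}. u i \<in> cap 1 w"
    by (rule evenly_spread_meets_caps[OF assms(2)]) auto
  then show ?thesis
    using eventually_ge_at_top[of "DIM('a) + 1"]
  proof eventually_elim
    case (elim k)
    then show ?case
      using assms positive_hull_eq_UNIV[OF elim(1)]
      by (simp add: noisy_support_lsq_input_def evenly_spread_def)
  qed
qed

section \<open>Noise averages of Lipschitz functions\<close>

text \<open>The fibres of \<open>q\<close> are the cells of the partition, represented by points of \<open>S\<close> itself so that
bounds on \<open>S\<close> apply at the representatives.\<close>
lemma compact_quantization:
  fixes S :: "'a::metric_space set"
  assumes "compact S" "0 < \<delta>"
  obtains q where "finite (q ` S)" "q ` S \<subseteq> S" "\<forall>v\<in>S. dist v (q v) < \<delta>"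
proof -
  obtain F where F: "finite F" "F \<subseteq> S" "S \<subseteq> (\<Union>c\<in>F. ball c \<delta>)"
    using seq_compact_imp_totally_bounded assms compact_imp_seq_compact by metis
  then have "\<forall>v\<in>S. \<exists>c\<in>F. dist v c < \<delta>"
    by (auto simp: dist_commute subset_eq)
  then obtain q where "\<forall>v\<in>S. q v \<in> F \<and> dist v (q v) < \<delta>"
    by metis
  with F that[of q] show thesis
    by (meson finite_subset image_subsetI order_trans)
qed

text \<open>Replacing \<open>f\<close> by the step function \<open>f \<circ> q\<close> costs \<open>\<Lambda> * \<delta>\<close> per unit of \<open>\<bar>x i\<bar>\<close>; for
the step function the sum can be grouped by cells. The bound depends on \<open>f\<close> only through
\<open>\<Lambda>\<close>, which makes it uniform over all functions with these Lipschitz and sup bounds.\<close>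
lemma weighted_sum_Lipschitz_le:
  fixes f :: "'a::metric_space \<Rightarrow> real" and x :: "nat \<Rightarrow> real"
  assumes "finite I" and u: "\<And>i. i \<in> I \<Longrightarrow> u i \<in> S"
    and q: "finite (q ` S)" "q ` S \<subseteq> S" "\<forall>v\<in>S. dist v (q v) < \<delta>"
    and bound: "\<And>v. v \<in> S \<Longrightarrow> \<bar>f v\<bar> \<le> \<Lambda>"
    and lip: "\<And>v w. \<bar>f v - f w\<bar> \<le> \<Lambda> * dist v w" and "0 \<le> \<Lambda>"
  shows "(\<Sum>i\<in>I. x i * f (u i))
    \<le> \<Lambda> * (\<delta> * (\<Sum>i\<in>I. \<bar>x i\<bar>) + (\<Sum>c\<in>q ` S. \<bar>\<Sum>i\<in>I. of_bool (q (u i) = c) * x i\<bar>))"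
proof -
  have near: "(\<Sum>i\<in>I. x i * (f (u i) - f (q (u i)))) \<le> \<Lambda> * (\<delta> * (\<Sum>i\<in>I. \<bar>x i\<bar>))"
  proof -
    have "x i * (f (u i) - f (q (u i))) \<le> \<Lambda> * \<delta> * \<bar>x i\<bar>" if "i \<in> I" for i
    proof -
      have "x i * (f (u i) - f (q (u i))) \<le> \<bar>x i\<bar> * \<bar>f (u i) - f (q (u i))\<bar>"
        by (metis abs_ge_self abs_mult)
      also have "\<dots> \<le> \<bar>x i\<bar> * (\<Lambda> * \<delta>)"
      proof (rule mult_left_mono)
        show "\<bar>f (u i) - f (q (u i))\<bar> \<le> \<Lambda> * \<delta>"
          by (rule order_trans[OF lip])
            (use q u[OF that] \<open>0 \<le> \<Lambda>\<close> in \<open>auto intro: mult_left_mono less_imp_le\<close>)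
      qed simp
      finally show ?thesis
        by (simp add: mult_ac)
    qed
    then have "(\<Sum>i\<in>I. x i * (f (u i) - f (q (u i)))) \<le> (\<Sum>i\<in>I. \<Lambda> * \<delta> * \<bar>x i\<bar>)"
      by (rule sum_mono)
    then show ?thesis
      by (simp add: sum_distrib_left mult_ac)
  qed
  have "(\<Sum>i\<in>I. x i * f (q (u i))) = (\<Sum>i\<in>I. \<Sum>c\<in>q ` S. f c * (of_bool (q (u i) = c) * x i))"
  proof (rule sum.cong[OF refl])
    fix i assume "i \<in> I"
    have "(\<Sum>c\<in>q ` S. f c * (of_bool (q (u i) = c) * x i))
        = (\<Sum>c\<in>q ` S. if c = q (u i) then f c * x i else 0)"
      by (rule sum.cong) auto
    also have "\<dots> = x i * f (q (u i))"
      using q(1) u[OF \<open>i \<in> I\<close>] by simp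
    finally show "x i * f (q (u i)) = (\<Sum>c\<in>q ` S. f c * (of_bool (q (u i) = c) * x i))" ..
  qed
  also have "\<dots> = (\<Sum>c\<in>q ` S. f c * (\<Sum>i\<in>I. of_bool (q (u i) = c) * x i))"
    by (subst sum.swap) (simp add: sum_distrib_left)
  also have "\<dots> \<le> (\<Sum>c\<in>q ` S. \<Lambda> * \<bar>\<Sum>i\<in>I. of_bool (q (u i) = c) * x i\<bar>)"
  proof (rule sum_mono)
    fix c assume "c \<in> q ` S"
    then have "\<bar>f c\<bar> \<le> \<Lambda>"
      using bound q(2) by blast
    then have "\<bar>f c * (\<Sum>i\<in>I. of_bool (q (u i) = c) * x i)\<bar>
        \<le> \<Lambda> * \<bar>\<Sum>i\<in>I. of_bool (q (u i) = c) * x i\<bar>"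
      unfolding abs_mult by (rule mult_right_mono) (rule abs_ge_zero)
    then show "f c * (\<Sum>i\<in>I. of_bool (q (u i) = c) * x i)
        \<le> \<Lambda> * \<bar>\<Sum>i\<in>I. of_bool (q (u i) = c) * x i\<bar>"
      by (rule order_trans[OF abs_ge_self])
  qed
  finally have cells: "(\<Sum>i\<in>I. x i * f (q (u i)))
      \<le> \<Lambda> * (\<Sum>c\<in>q ` S. \<bar>\<Sum>i\<in>I. of_bool (q (u i) = c) * x i\<bar>)"
    by (simp add: sum_distrib_left)
  have "(\<Sum>i\<in>I. x i * f (u i))
      = (\<Sum>i\<in>I. x i * (f (u i) - f (q (u i)))) + (\<Sum>i\<in>I. x i * f (q (u i)))"
    by (simp add: sum.distrib[symmetric] algebra_simps)
  with near cells show ?thesis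
    by (simp add: distrib_left)
qed

section \<open>Outputs of the least squares problem\<close>

text \<open>A compact convex set \<open>L\<close> that witnesses the consistency of the solution \<open>h\<close> is contained in
the output \<open>Q\<close>; hence \<open>Q\<close> is nonempty and its support function lies between that of \<open>L\<close> and
\<open>h\<close> at the given directions. Boundedness of \<open>Q\<close> is a premise of that equation only, because
the other conclusions are what bounds \<open>Q\<close> later. The last conclusion compares the
minimum with the feasible values of \<open>K\<close>.\<close>
lemma lsq_output_cases:
  fixes K :: "'a::euclidean_space set"
  assumes out: "noisy_support_lsq_output R u (\<lambda>i. support_fn K (u i) + x i) k Q"
    and K: "compact K" "convex K" "K \<noteq> {}"
    and R: "R = UNIV \<or> (R = {0..} \<and> 0 \<in> K)"
  obtains h where "Q \<noteq> {}" "\<And>z i. z \<in> Q \<Longrightarrow> i \<in> {1..k} \<Longrightarrow> u i \<bullet> z \<le> h i"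
    "bounded Q \<Longrightarrow> \<forall>i\<in>{1..k}. support_fn Q (u i) = h i"
    "(\<Sum>i=1..k. (h i - support_fn K (u i))\<^sup>2) \<le> 2 * (\<Sum>i=1..k. x i * (h i - support_fn K (u i)))"
proof -
  let ?K = "\<lambda>i. support_fn K (u i)"
  obtain h where min: "is_arg_min (\<lambda>h. \<Sum>i=1..k. (?K i + x i - h i)\<^sup>2) (consistent R u k) h"
    and Q: "Q = (\<Inter>i\<in>{1..k}. {z. z \<bullet> u i \<le> h i})"
    using out unfolding noisy_support_lsq_output_def by blast
  then obtain L where L: "compact L" "L \<noteq> {}" "\<And>i. i \<in> {1..k} \<Longrightarrow> support_fn L (u i) = h i"
    unfolding is_arg_min_def consistent_def by blast
  have inQ: "u i \<bullet> z \<le> h i" if "z \<in> Q" "i \<in> {1..k}" for z i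
    using that by (auto simp: Q inner_commute)
  have "L \<subseteq> Q"
  proof
    fix y assume "y \<in> L"
    then have "y \<bullet> u i \<le> h i" if "i \<in> {1..k}" for i
      using support_fn_upper[OF compact_imp_bounded[OF \<open>compact L\<close>], of y "u i"] L(3)[OF that]
      by (simp add: inner_commute)
    then show "y \<in> Q"
      by (auto simp: Q)
  qed
  with \<open>L \<noteq> {}\<close> have "Q \<noteq> {}"
    by blast
  have supp: "support_fn Q (u i) = h i" if "bounded Q" "i \<in> {1..k}" for i
  proof (rule antisym)
    show "support_fn Q (u i) \<le> h i"
      using \<open>Q \<noteq> {}\<close> inQ that(2) by (intro support_fn_least)
    have "support_fn L (u i) \<le> support_fn Q (u i)"
      using \<open>L \<noteq> {}\<close> \<open>L \<subseteq> Q\<close> that(1) by (intro support_fn_least support_fn_upper) auto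
    with L(3) that(2) show "h i \<le> support_fn Q (u i)"
      by simp
  qed
  have "consistent R u k ?K"
    using R K support_fn_upper[OF compact_imp_bounded[OF \<open>compact K\<close>], of 0]
    unfolding consistent_def by auto
  then have "(\<Sum>i=1..k. (?K i + x i - h i)\<^sup>2) \<le> (\<Sum>i=1..k. (?K i + x i - ?K i)\<^sup>2)"
    using min unfolding is_arg_min_def by (meson linorder_not_less)
  moreover have "(?K i + x i - h i)\<^sup>2
      = (x i)\<^sup>2 + (h i - ?K i)\<^sup>2 - 2 * (x i * (h i - ?K i))" for i
    by (simp add: power2_eq_square algebra_simps)
  ultimately have "(\<Sum>i=1..k. (h i - ?K i)\<^sup>2) \<le> 2 * (\<Sum>i=1..k. x i * (h i - ?K i))"
    by (simp add: sum.distrib sum_subtractf sum_distrib_left)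
  then show thesis
    using that \<open>Q \<noteq> {}\<close> inQ supp by blast
qed

text \<open>Young's inequality \<open>2 * (x * d) \<le> 2 * x\<^sup>2 + d\<^sup>2 / 2\<close>, with half of the sum of the \<open>d\<^sup>2\<close>
absorbed on the left.\<close>
lemma sum_squares_le_of_cross_term:
  fixes d x :: "'i \<Rightarrow> real"
  assumes "(\<Sum>i\<in>I. (d i)\<^sup>2) \<le> 2 * (\<Sum>i\<in>I. x i * d i)"
  shows "(\<Sum>i\<in>I. (d i)\<^sup>2) \<le> 4 * (\<Sum>i\<in>I. (x i)\<^sup>2)"
proof -
  have "2 * (x i * d i) \<le> 2 * (x i)\<^sup>2 + (d i)\<^sup>2 / 2" for i
    using zero_le_power2[of "2 * x i - d i"] by (simp add: power2_eq_square algebra_simps)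
  then have "2 * (\<Sum>i\<in>I. x i * d i) \<le> (\<Sum>i\<in>I. 2 * (x i)\<^sup>2 + (d i)\<^sup>2 / 2)"
    unfolding sum_distrib_left by (rule sum_mono)
  also have "\<dots> = 2 * (\<Sum>i\<in>I. (x i)\<^sup>2) + (\<Sum>i\<in>I. (d i)\<^sup>2) / 2"
    by (simp add: sum.distrib sum_distrib_left sum_divide_distrib)
  finally show ?thesis
    using assms by simp
qed

text \<open>If \<open>z\<close> lies in the output, then \<open>h i \<ge> u i \<bullet> z \<ge> norm z / 2\<close> for all directions in the
cap of radius \<open>1\<close> around \<open>z / norm z\<close>, whereas the values of \<open>K\<close> are at most \<open>s\<close>. The cap
estimate with \<open>a = norm z / 2 - s\<close> and the bound \<open>4 * C * k\<close> on the squared errors give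
\<open>a\<^sup>2 \<le> 4 * C / c\<close>.\<close>
lemma lsq_outputs_bounded:
  fixes K :: "'a::euclidean_space set"
  assumes K: "compact K" "convex K" "K \<noteq> {}"
    and R: "R = UNIV \<or> (R = {0..} \<and> 0 \<in> K)"
    and u: "evenly_spread u"
    and squares: "\<forall>\<^sub>F k in sequentially. (\<Sum>i=1..k. (x i)\<^sup>2) \<le> C * real k"
    and out: "\<forall>\<^sub>F k in sequentially.
      noisy_support_lsq_output R u (\<lambda>i. support_fn K (u i) + x i) k (Q k)"
  obtains r where "0 \<le> r" "K \<subseteq> cball 0 r"
    "\<forall>\<^sub>F k in sequentially. Q k \<noteq> {} \<and> Q k \<subseteq> cball 0 r \<and>
       (\<Sum>i=1..k. (support_fn (Q k) (u i) - support_fn K (u i))\<^sup>2)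
         \<le> 2 * (\<Sum>i=1..k. x i * (support_fn (Q k) (u i) - support_fn K (u i)))"
proof -
  obtain s where "0 < s" and s: "K \<subseteq> cball 0 s"
    using compact_imp_bounded[OF \<open>compact K\<close>] by (auto simp: bounded_pos subset_eq)
  obtain c where "c > 0" and c: "\<forall>\<^sub>F k in sequentially. \<forall>w\<in>sphere 0 1. \<forall>d a. 0 \<le> a \<longrightarrow>
       (\<forall>i\<in>{1..k}. u i \<in> cap 1 w \<longrightarrow> a \<le> \<bar>d i\<bar>) \<longrightarrow> c * real k * a\<^sup>2 \<le> (\<Sum>i=1..k. (d i)\<^sup>2)"
    by (rule evenly_spread_sum_squares[OF u, of 1]) (auto intro: that)
  define \<rho> where "\<rho> = sqrt (4 * \<bar>C\<bar> / c)"
  have "0 \<le> \<rho>"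
    using \<open>c > 0\<close> by (simp add: \<rho>_def)
  define r where "r = 2 * (s + \<rho>)"
  have "\<forall>\<^sub>F k in sequentially. Q k \<noteq> {} \<and> Q k \<subseteq> cball 0 r \<and>
       (\<Sum>i=1..k. (support_fn (Q k) (u i) - support_fn K (u i))\<^sup>2)
         \<le> 2 * (\<Sum>i=1..k. x i * (support_fn (Q k) (u i) - support_fn K (u i)))"
    using squares out c eventually_gt_at_top[of 0]
  proof eventually_elim
    case (elim k)
    obtain h where h: "Q k \<noteq> {}" "\<And>z i. z \<in> Q k \<Longrightarrow> i \<in> {1..k} \<Longrightarrow> u i \<bullet> z \<le> h i"
      "bounded (Q k) \<Longrightarrow> \<forall>i\<in>{1..k}. support_fn (Q k) (u i) = h i"
      "(\<Sum>i=1..k. (h i - support_fn K (u i))\<^sup>2) \<le> 2 * (\<Sum>i=1..k. x i * (h i - support_fn K (u i)))"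
      by (rule lsq_output_cases[OF elim(2) K R]) (rule that)
    define d where "d i = h i - support_fn K (u i)" for i
    have d_squares: "(\<Sum>i=1..k. (d i)\<^sup>2) \<le> 4 * (C * real k)"
      using sum_squares_le_of_cross_term[OF h(4)] elim(1) by (simp add: d_def)
    have "Q k \<subseteq> cball 0 r"
    proof
      fix z assume "z \<in> Q k"
      define a where "a = norm z / 2 - s"
      have "a \<le> \<rho>"
      proof (cases "0 \<le> a")
        case True
        with \<open>0 < s\<close> have "z \<noteq> 0"
          by (auto simp: a_def)
        define w where "w = z /\<^sub>R norm z"
        have w: "w \<in> sphere 0 1"
          using \<open>z \<noteq> 0\<close> by (simp add: w_def)
        have "a \<le> \<bar>d i\<bar>" if i: "i \<in> {1..k}" "u i \<in> cap 1 w" for i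
        proof -
          have "z = norm z *\<^sub>R w"
            using \<open>z \<noteq> 0\<close> by (simp add: w_def)
          then have "u i \<bullet> z = norm z * (w \<bullet> u i)"
            by (metis inner_commute inner_scaleR_left)
          moreover have "norm z * (1 / 2) \<le> norm z * (w \<bullet> u i)"
            using inner_gt_half_of_cap[OF w i(2)] by (intro mult_left_mono) auto
          moreover have "\<bar>support_fn K (u i)\<bar> \<le> s"
            using support_fn_abs_le[OF \<open>K \<noteq> {}\<close> s, of "u i"] i by (simp add: cap_def)
          ultimately show ?thesis
            using h(2)[OF \<open>z \<in> Q k\<close> i(1)] by (simp add: a_def d_def)
        qed
        then have "c * real k * a\<^sup>2 \<le> 4 * (C * real k)"
          using elim(3) w True d_squares by (meson order_trans)
        also have "\<dots> \<le> 4 * \<bar>C\<bar> * real k"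
          by (simp add: mult_right_mono)
        finally have "a\<^sup>2 \<le> 4 * \<bar>C\<bar> / c"
          using \<open>c > 0\<close> \<open>0 < k\<close> by (simp add: field_simps)
        then show ?thesis
          unfolding \<rho>_def by (rule real_le_rsqrt)
      qed (use \<open>0 \<le> \<rho>\<close> in simp)
      then show "z \<in> cball 0 r"
        by (simp add: a_def r_def)
    qed
    moreover from this have "\<forall>i\<in>{1..k}. support_fn (Q k) (u i) = h i"
      using h(3) bounded_cball bounded_subset by blast
    ultimately show ?case
      using h(1,4) by simp
  qed
  moreover have "K \<subseteq> cball 0 r" "0 \<le> r"
    using s \<open>0 < s\<close> \<open>0 \<le> \<rho>\<close> by (auto simp: r_def)
  ultimately show thesis
    using that by blast
qed

text \<open>The deterministic core: convergence holds at every sample point whose noise has bounded mean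
squares and vanishing averages over the cells of arbitrarily fine partitions of the sphere.\<close>
lemma lsq_outputs_converge:
  fixes K :: "'a::euclidean_space set"
  assumes K: "compact K" "convex K" "K \<noteq> {}"
    and R: "R = UNIV \<or> (R = {0..} \<and> 0 \<in> K)"
    and u: "evenly_spread u"
    and squares: "\<forall>\<^sub>F k in sequentially. (\<Sum>i=1..k. (x i)\<^sup>2) \<le> C * real k"
    and cells: "\<And>\<delta>. 0 < \<delta> \<Longrightarrow> \<exists>q. finite (q ` sphere 0 1) \<and> q ` sphere 0 1 \<subseteq> sphere 0 1 \<and>
      (\<forall>v\<in>sphere 0 1. dist v (q v) < \<delta>) \<and>
      (\<forall>c\<in>q ` sphere 0 1. (\<lambda>k. (\<Sum>i=1..k. of_bool (q (u i) = c) * x i) / real k) \<longlonglongrightarrow> 0)"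
    and out: "\<forall>\<^sub>F k in sequentially.
      noisy_support_lsq_output R u (\<lambda>i. support_fn K (u i) + x i) k (Q k)"
  shows "(\<lambda>k. hausdorff_delta K (Q k)) \<longlonglongrightarrow> 0"
proof -
  let ?S = "sphere (0::'a) 1"
  define f where "f k v = support_fn (Q k) v - support_fn K v" for k v
  obtain r where "0 \<le> r" and Kr: "K \<subseteq> cball 0 r"
    and good: "\<forall>\<^sub>F k in sequentially. Q k \<noteq> {} \<and> Q k \<subseteq> cball 0 r \<and>
       (\<Sum>i=1..k. (f k (u i))\<^sup>2) \<le> 2 * (\<Sum>i=1..k. x i * f k (u i))"
    by (rule lsq_outputs_bounded[OF K R u squares out, folded f_def]) (rule that)
  \<comment> \<open>The summand \<open>1\<close> keeps \<open>\<Lambda>\<close> positive, as it is used as a divisor.\<close>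
  define \<Lambda> where "\<Lambda> = 2 * r + 1"
  have "0 < \<Lambda>"
    using \<open>0 \<le> r\<close> by (simp add: \<Lambda>_def)
  have lip: "\<bar>f k v - f k w\<bar> \<le> \<Lambda> * dist v w" and bound: "v \<in> ?S \<Longrightarrow> \<bar>f k v\<bar> \<le> \<Lambda>"
    if "Q k \<noteq> {}" "Q k \<subseteq> cball 0 r" for k v w
  proof -
    have "\<bar>f k v - f k w\<bar> \<le> 2 * r * norm (v - w)"
      using support_fn_Lipschitz[OF that, of v w] support_fn_Lipschitz[OF K(3) Kr, of v w]
      by (simp add: f_def)
    then show "\<bar>f k v - f k w\<bar> \<le> \<Lambda> * dist v w"
      by (simp add: \<Lambda>_def dist_norm distrib_right) (smt (verit) norm_ge_zero)
    show "\<bar>f k v\<bar> \<le> \<Lambda>" if "v \<in> ?S"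
      using support_fn_abs_le[OF \<open>Q k \<noteq> {}\<close> \<open>Q k \<subseteq> cball 0 r\<close>, of v]
        support_fn_abs_le[OF K(3) Kr, of v] that
      by (simp add: f_def \<Lambda>_def)
  qed

  have mean_squares: "\<forall>\<^sub>F k in sequentially. (\<Sum>i=1..k. (f k (u i))\<^sup>2) \<le> \<eta> * real k"
    if "0 < \<eta>" for \<eta>
  proof -
    \<comment> \<open>The mean of \<open>\<bar>x i\<bar>\<close> is at most \<open>1 + \<bar>C\<bar>\<close>, so this mesh makes the quantization error at
      most \<open>\<eta> / 4\<close>; the cells contribute at most the same, and the basic inequality doubles the sum.\<close>
    define \<delta> where "\<delta> = \<eta> / (4 * \<Lambda> * (1 + \<bar>C\<bar>))"
    have "0 < \<delta>"
      using \<open>0 < \<eta>\<close> \<open>0 < \<Lambda>\<close> by (simp add: \<delta>_def)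
    have \<delta>_eq: "\<delta> * (1 + \<bar>C\<bar>) = \<eta> / (4 * \<Lambda>)"
    proof -
      have "1 + \<bar>C\<bar> \<noteq> 0"
        by linarith
      then show ?thesis
        by (simp add: \<delta>_def)
    qed
    obtain q where q: "finite (q ` ?S)" "q ` ?S \<subseteq> ?S" "\<forall>v\<in>?S. dist v (q v) < \<delta>"
      and null: "\<forall>c\<in>q ` ?S. (\<lambda>k. (\<Sum>i=1..k. of_bool (q (u i) = c) * x i) / real k) \<longlonglongrightarrow> 0"
      using cells[OF \<open>0 < \<delta>\<close>] by blast
    have "(\<lambda>k. \<Sum>c\<in>q ` ?S. \<bar>(\<Sum>i=1..k. of_bool (q (u i) = c) * x i) / real k\<bar>) \<longlonglongrightarrow> 0"
      by (intro tendsto_null_sum tendsto_rabs_zero null[rule_format])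
    moreover have "0 < \<eta> / (4 * \<Lambda>)"
      using \<open>0 < \<eta>\<close> \<open>0 < \<Lambda>\<close> by simp
    ultimately have "\<forall>\<^sub>F k in sequentially.
        (\<Sum>c\<in>q ` ?S. \<bar>(\<Sum>i=1..k. of_bool (q (u i) = c) * x i) / real k\<bar>) < \<eta> / (4 * \<Lambda>)"
      by (rule order_tendstoD(2))
    then show ?thesis
      using good squares eventually_gt_at_top[of 0]
    proof eventually_elim
      case (elim k)
      have "(\<Sum>c\<in>q ` ?S. \<bar>\<Sum>i=1..k. of_bool (q (u i) = c) * x i\<bar>)
          = real k * (\<Sum>c\<in>q ` ?S. \<bar>(\<Sum>i=1..k. of_bool (q (u i) = c) * x i) / real k\<bar>)"
        using \<open>0 < k\<close> by (simp add: sum_distrib_left)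
      also have "\<dots> \<le> real k * (\<eta> / (4 * \<Lambda>))"
        using elim(1) by (intro mult_left_mono) auto
      finally have cell_sum: "(\<Sum>c\<in>q ` ?S. \<bar>\<Sum>i=1..k. of_bool (q (u i) = c) * x i\<bar>)
          \<le> real k * (\<eta> / (4 * \<Lambda>))" .
      have "\<bar>y\<bar> \<le> 1 + y\<^sup>2" for y :: real
        using zero_le_power2[of "\<bar>y\<bar> - 1 / 2"] by (simp add: power2_eq_square algebra_simps)
      then have "(\<Sum>i=1..k. \<bar>x i\<bar>) \<le> (\<Sum>i=1..k. 1 + (x i)\<^sup>2)"
        by (intro sum_mono)
      also have "\<dots> \<le> (1 + \<bar>C\<bar>) * real k"
        using elim(3) mult_right_mono[OF abs_ge_self[of C], of "real k"]
        by (simp add: sum.distrib distrib_right)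
      finally have "\<delta> * (\<Sum>i=1..k. \<bar>x i\<bar>) \<le> \<delta> * ((1 + \<bar>C\<bar>) * real k)"
        using \<open>0 < \<delta>\<close> by (intro mult_left_mono) auto
      also have "\<dots> = real k * (\<eta> / (4 * \<Lambda>))"
        by (simp only: mult.assoc[symmetric] \<delta>_eq) (rule mult.commute)
      finally have "\<Lambda> * (\<delta> * (\<Sum>i=1..k. \<bar>x i\<bar>)
            + (\<Sum>c\<in>q ` ?S. \<bar>\<Sum>i=1..k. of_bool (q (u i) = c) * x i\<bar>))
          \<le> \<Lambda> * (real k * (\<eta> / (4 * \<Lambda>)) + real k * (\<eta> / (4 * \<Lambda>)))"
        using \<open>0 < \<Lambda>\<close> cell_sum by (intro mult_left_mono add_mono) auto
      also have "\<dots> = \<eta> * real k / 2"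
        using \<open>0 < \<Lambda>\<close> by (simp add: field_simps)
      finally have "(\<Sum>i=1..k. x i * f k (u i)) \<le> \<eta> * real k / 2"
      proof (rule order_trans[rotated])
        show "(\<Sum>i=1..k. x i * f k (u i)) \<le> \<Lambda> * (\<delta> * (\<Sum>i=1..k. \<bar>x i\<bar>)
            + (\<Sum>c\<in>q ` ?S. \<bar>\<Sum>i=1..k. of_bool (q (u i) = c) * x i\<bar>))"
        proof (rule weighted_sum_Lipschitz_le[OF _ _ q])
          show "u i \<in> ?S" if "i \<in> {1..k}" for i
            using u that by (simp add: evenly_spread_def)
        qed (use bound lip elim(2) \<open>0 < \<Lambda>\<close> in auto)
      qed
      then show ?case
        using elim(2) by linarith
    qed
  qed

  have *: "\<forall>\<^sub>F k in sequentially. \<bar>hausdorff_delta K (Q k)\<bar> \<le> \<epsilon>" if "0 < \<epsilon>" for \<epsilon>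
  proof -
    \<comment> \<open>Within distance \<open>t\<close> of a point where \<open>\<bar>f k\<bar>\<close> exceeds \<open>\<epsilon>\<close> it is still at least \<open>\<epsilon> / 2\<close>.\<close>
    define t where "t = min 1 (\<epsilon> / (2 * \<Lambda>))"
    have t: "0 < t" "t < 2" "\<Lambda> * t \<le> \<epsilon> / 2"
      using \<open>0 < \<epsilon>\<close> \<open>0 < \<Lambda>\<close> by (auto simp: t_def min_def field_simps)
    obtain c where "c > 0" and c: "\<forall>\<^sub>F k in sequentially. \<forall>w\<in>?S. \<forall>d a. 0 \<le> a \<longrightarrow>
       (\<forall>i\<in>{1..k}. u i \<in> cap t w \<longrightarrow> a \<le> \<bar>d i\<bar>) \<longrightarrow> c * real k * a\<^sup>2 \<le> (\<Sum>i=1..k. (d i)\<^sup>2)"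
      by (rule evenly_spread_sum_squares[OF u t(1,2)]) (rule that)
    have "0 < c * (\<epsilon> / 2)\<^sup>2 / 2"
      using \<open>0 < c\<close> \<open>0 < \<epsilon>\<close> by simp
    from good mean_squares[OF this] c eventually_gt_at_top[of 0] show ?thesis
    proof eventually_elim
      case (elim k)
      have "\<bar>f k v\<bar> \<le> \<epsilon>" if v: "v \<in> ?S" for v
      proof (rule ccontr)
        assume large: "\<not> \<bar>f k v\<bar> \<le> \<epsilon>"
        have "\<epsilon> / 2 \<le> \<bar>f k (u i)\<bar>" if "u i \<in> cap t v" for i
        proof -
          have "\<Lambda> * dist v (u i) \<le> \<Lambda> * t"
            using that \<open>0 < \<Lambda>\<close> by (intro mult_left_mono) (auto simp: cap_def dist_norm)
          then have "\<bar>f k v - f k (u i)\<bar> \<le> \<epsilon> / 2"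
            using lip[of k v "u i"] elim(1) t(3) by linarith
          with large show ?thesis
            by linarith
        qed
        then have "c * real k * (\<epsilon> / 2)\<^sup>2 \<le> (\<Sum>i=1..k. (f k (u i))\<^sup>2)"
          using elim(3) v \<open>0 < \<epsilon>\<close> by auto
        also have "\<dots> \<le> c * (\<epsilon> / 2)\<^sup>2 / 2 * real k"
          by (rule elim(2))
        finally show False
          using \<open>0 < c\<close> \<open>0 < \<epsilon>\<close> \<open>0 < k\<close> by simp
      qed
      then have f_le: "\<bar>support_fn K v - support_fn (Q k) v\<bar> \<le> \<epsilon>" if "v \<in> ?S" for v
        using that by (simp add: f_def abs_minus_commute)
      obtain e :: 'a where "e \<in> ?S"
        using vector_choose_size[of 1] by auto
      have "hausdorff_delta K (Q k) \<le> \<epsilon>"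
        unfolding hausdorff_delta_def using \<open>e \<in> ?S\<close> f_le by (intro cSUP_least) auto
      moreover have "\<bar>support_fn K e - support_fn (Q k) e\<bar> \<le> hausdorff_delta K (Q k)"
        unfolding hausdorff_delta_def using \<open>e \<in> ?S\<close> f_le
        by (intro cSUP_upper2[where x = e] bdd_aboveI2[where M = \<epsilon>]) auto
      ultimately show ?case
        by linarith
    qed
  qed
  have "\<forall>\<^sub>F k in sequentially. dist (hausdorff_delta K (Q k)) 0 < \<epsilon>" if "0 < \<epsilon>" for \<epsilon>
  proof -
    have "\<forall>\<^sub>F k in sequentially. \<bar>hausdorff_delta K (Q k)\<bar> \<le> \<epsilon> / 2"
      using \<open>0 < \<epsilon>\<close> by (intro *) simp
    then show ?thesis
      by eventually_elim (use \<open>0 < \<epsilon>\<close> in auto)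
  qed
  then show ?thesis
    by (rule tendstoI)
qed

section \<open>Almost sure convergence\<close>

theorem theorem6p1:
  fixes K :: "'a::euclidean_space set"
    and u :: "nat \<Rightarrow> 'a"
    and M :: "'w measure"
    and X :: "nat \<Rightarrow> 'w \<Rightarrow> real"
    and \<sigma> :: real
    and R :: "real set"
    and P :: "nat \<Rightarrow> 'w \<Rightarrow> 'a set"
  assumes "DIM('a) \<ge> 2"
    and "convex_body K"
    and "evenly_spread u"
    and "prob_space M"
    and "\<sigma> > 0"
    and "prob_space.indep_vars M (\<lambda>_. borel) X {1..}"
    and "\<And>i. i \<ge> 1 \<Longrightarrow> distributed M lborel (X i) (normal_density 0 \<sigma>)"
    and "R = UNIV \<or> (R = {0..} \<and> 0 \<in> K)"
    and "\<And>k \<omega>. \<omega> \<in> space M \<Longrightarrow> noisy_support_lsq_input u k \<Longrightarrow>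
           noisy_support_lsq_output R u (\<lambda>i. support_fn K (u i) + X i \<omega>) k (P k \<omega>)"
  shows "AE \<omega> in M. (\<lambda>k. hausdorff_delta K (P k \<omega>)) \<longlonglongrightarrow> 0"
proof -
  interpret prob_space M by fact
  let ?S = "sphere (0::'a) 1"
  have K: "compact K" "convex K" "K \<noteq> {}"
    using \<open>convex_body K\<close> by (auto simp: convex_body_def)
  have "\<exists>q. finite (q ` ?S) \<and> q ` ?S \<subseteq> ?S \<and> (\<forall>v\<in>?S. dist v (q v) < inverse (real (Suc m)))" for m
    by (rule compact_quantization[of ?S "inverse (real (Suc m))"]) auto
  then obtain q where q: "\<And>m. finite (q m ` ?S)" "\<And>m. q m ` ?S \<subseteq> ?S"
    "\<And>m. \<forall>v\<in>?S. dist v (q m v) < inverse (real (Suc m))"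
    by metis
  have squares: "AE \<omega> in M. \<forall>\<^sub>F k in sequentially. (\<Sum>i=1..k. (X i \<omega>)\<^sup>2) \<le> 4 * \<sigma>\<^sup>2 * ln 2 * real k"
    using assms(5-7) by (intro AE_normal_squares_bounded_average)
  \<comment> \<open>Meshes from a fixed null sequence leave only countably many exceptional null sets.\<close>
  have cells: "AE \<omega> in M. \<forall>m. \<forall>c\<in>q m ` ?S.
      (\<lambda>k. (\<Sum>i=1..k. of_bool (q m (u i) = c) * X i \<omega>) / real k) \<longlonglongrightarrow> 0"
    unfolding AE_all_countable
    using assms(5-7) q(1) by (intro allI AE_finite_allI AE_weighted_normal_average_null) auto
  show ?thesis
    using squares cells AE_space
  proof eventually_elim
    case (elim \<omega>)
    show ?case
    proof (rule lsq_outputs_converge[OF K assms(8,3) elim(1)])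
      show "\<forall>\<^sub>F k in sequentially.
          noisy_support_lsq_output R u (\<lambda>i. support_fn K (u i) + X i \<omega>) k (P k \<omega>)"
        using eventually_noisy_support_lsq_input[OF assms(1,3)]
        by eventually_elim (rule assms(9)[OF elim(3)])
    next
      fix \<delta> :: real assume "0 < \<delta>"
      then obtain m where "inverse (real (Suc m)) < \<delta>"
        using reals_Archimedean by blast
      then have "\<forall>v\<in>?S. dist v (q m v) < \<delta>"
        using q(3)[of m] by fastforce
      then show "\<exists>q. finite (q ` ?S) \<and> q ` ?S \<subseteq> ?S \<and> (\<forall>v\<in>?S. dist v (q v) < \<delta>) \<and>
          (\<forall>c\<in>q ` ?S. (\<lambda>k. (\<Sum>i=1..k. of_bool (q (u i) = c) * X i \<omega>) / real k) \<longlonglongrightarrow> 0)"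
        using q(1)[of m] q(2)[of m] elim(2) by blast
    qed
  qed
qed

end
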